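(* Let $\lambda=\mu^+$ for $\mu$ singular, and let $(\bar C,\bar I)$ be an $S$-good pair for some stationary $S\subseteq\{\delta<\lambda:\mathrm{cf}(\delta)=\mathrm{cf}(\mu)\}$. If $\bar e=\langle e_\alpha:\alpha<\lambda\rangle$ is a $C$-sequence such that $|e_\alpha|<\mu$ for all $\alpha<\lambda$ and $\bar e$ swallows $(\bar C,\bar I)$, then the trace filter of $\bar e$ is disjoint from the ideal $\mathrm{id}_p(\bar C,\bar I)$. In particular, the trace filter of $\bar e$ is a proper uniform filter on $\lambda$ disjoint from the nonstationary ideal.
   Context: For a closed set $C$, $\mathrm{nacc}(C)=\{\alpha\in C:\sup(C\cap\alpha)<\alpha\}$, $\mathrm{acc}(C)=C\setminus\mathrm{nacc}(C)$. An $S$-good pair is $(\bar C,\bar I)$ where: $\bar C=\langle C_\delta:\delta\in S\rangle$ with each $C_\delta$ closed unbounded in $\delta$; $\sup\{|C_\delta|:\delta\in S\}<\mu$; $\bar I=\langle I_\delta:\delta\in S\rangle$ with $I_\delta$ the ideal on $C_\delta$ generated by the sets $\{\gamma\in C_\delta:\gamma\in\mathrm{acc}(C_\delta)\text{ or }\mathrm{cf}(\gamma)<\alpha\text{ or }\gamma<\beta\}$ for $\alpha<\mu,\beta<\delta$; and for every club $E\subseteq\lambda$, $\{\delta\in S:E\cap C_\delta\notin I_\delta\}$ is stationary. $\mathrm{id}_p(\bar C,\bar I)$ is the ideal of all $A\subseteq\lambda$ such that for some club $E\subseteq\lambda$, $E\cap A\cap C_\delta\in I_\delta$ for all $\delta\in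 S\cap E$. A $C$-sequence on $\lambda$ is $\langle e_\alpha:\alpha<\lambda\rangle$ with $e_\alpha$ club in $\alpha$ for limit $\alpha$ and, for successor $\alpha$, $e_\alpha$ a closed subset of $\alpha$ containing the predecessor of $\alpha$. It swallows $(\bar C,\bar I)$ if $\delta\in e_\alpha\cap S$ implies $C_\delta\subseteq e_\alpha$. For $\alpha<\beta<\lambda$ the minimal walk from $\beta$ to $\alpha$ is $\beta=\beta_0>\dots>\beta_{n+1}=\alpha$ with $\beta_{i+1}=\min(e_{\beta_i}\setminus\alpha)$, and $\mathrm{tr}(\alpha,\beta)=\{\beta_0,\dots,\beta_{n+1}\}$. The trace filter of $\bar e$ is the filter on $\lambda$ generated by the sets $\bigcup\{\mathrm{tr}(\alpha,\beta):\{\alpha,\beta\}\in[A]^2\}$ for $A$ an unbounded subset of $\lambda$ (here for $\{\alpha,\beta\}$ with $\alpha<\beta$). *)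

theory Defs
  imports Main
begin

unbundle cardinal_syntax

text \<open>
  The cardinal \<open>\<lambda>\<close> is a well-ordered type \<open>'a\<close>, whose elements are the ordinals below \<open>\<lambda>\<close>.
  An ordinal \<open>\<delta> < \<lambda>\<close>, seen as a set, is \<open>{..<\<delta>}\<close>, and \<open>\<lambda>\<close> itself is \<open>UNIV\<close>.
\<close>

definition succ_cardinal_type :: "'a::wellorder \<Rightarrow> bool" where
  "succ_cardinal_type \<mu> \<longleftrightarrow> {(x, y). x \<le> (y::'a)} =o cardSuc |{..<\<mu>}|"

definition ord_sup :: "'a::wellorder set \<Rightarrow> 'a" where
  "ord_sup A = (LEAST x. \<forall>a\<in>A. a \<le> x)"

definition succ_of :: "'a::wellorder \<Rightarrow> 'a \<Rightarrow> bool" where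
  "succ_of \<beta> \<alpha> \<longleftrightarrow> {..<\<alpha>} = {..\<beta>}"

definition limit_ord :: "'a::wellorder \<Rightarrow> bool" where
  "limit_ord \<alpha> \<longleftrightarrow> {..<\<alpha>} \<noteq> {} \<and> \<not> (\<exists>\<beta>. succ_of \<beta> \<alpha>)"

definition unbounded_in :: "'a::wellorder set \<Rightarrow> 'a set \<Rightarrow> bool" where
  "unbounded_in D A \<longleftrightarrow> A \<subseteq> D \<and> (\<forall>x\<in>D. \<exists>a\<in>A. x \<le> a)"

definition closed_in :: "'a::wellorder set \<Rightarrow> 'a set \<Rightarrow> bool" where
  "closed_in D A \<longleftrightarrow>
     A \<subseteq> D \<and> (\<forall>\<gamma>\<in>D. limit_ord \<gamma> \<and> ord_sup (A \<inter> {..<\<gamma>}) = \<gamma> \<longrightarrow> \<gamma> \<in> A)"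

definition club_in :: "'a::wellorder set \<Rightarrow> 'a set \<Rightarrow> bool" where
  "club_in D A \<longleftrightarrow> closed_in D A \<and> unbounded_in D A"

definition stationary :: "'a::wellorder set \<Rightarrow> bool" where
  "stationary S \<longleftrightarrow> (\<forall>E. club_in UNIV E \<longrightarrow> S \<inter> E \<noteq> {})"

definition nonstationary_ideal :: "'a::wellorder set set" where
  "nonstationary_ideal = {A. \<not> stationary A}"

definition cf :: "'a::wellorder \<Rightarrow> 'a" where
  "cf \<gamma> = (LEAST \<kappa>. \<exists>A. unbounded_in {..<\<gamma>} A \<and> |A| =o |{..<\<kappa>}| )"

definition singular_cardinal :: "'a::wellorder \<Rightarrow> bool" where
  "singular_cardinal \<mu> \<longleftrightarrow>
     infinite {..<\<mu>} \<and> (\<forall>\<alpha><\<mu>. |{..<\<alpha>}| <o |{..<\<mu>}| ) \<and> cf \<mu> < \<mu>"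

definition nacc_pts :: "'a::wellorder set \<Rightarrow> 'a set" where
  "nacc_pts C = {\<alpha> \<in> C. ord_sup (C \<inter> {..<\<alpha>}) < \<alpha>}"

definition acc_pts :: "'a::wellorder set \<Rightarrow> 'a set" where
  "acc_pts C = C - nacc_pts C"

definition generated_ideal :: "'a set \<Rightarrow> 'a set set \<Rightarrow> 'a set set" where
  "generated_ideal X G = {A. A \<subseteq> X \<and> (\<exists>F. finite F \<and> F \<subseteq> G \<and> A \<subseteq> \<Union>F)}"

text \<open>
  The clause \<open>\<exists>\<kappa><\<mu>. \<dots>\<close> below says that the supremum of the cardinalities of the
  \<open>C \<delta>\<close> is less than \<open>\<mu>\<close>.
\<close>

definition good_pair ::
  "'a::wellorder \<Rightarrow> 'a set \<Rightarrow> ('a \<Rightarrow> 'a set) \<Rightarrow> ('a \<Rightarrow> 'a set set) \<Rightarrow> bool" where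
  "good_pair \<mu> S C I \<longleftrightarrow>
     (\<forall>\<delta>\<in>S. club_in {..<\<delta>} (C \<delta>)) \<and>
     (\<exists>\<kappa><\<mu>. \<forall>\<delta>\<in>S. |C \<delta>| \<le>o |{..<\<kappa>}| ) \<and>
     (\<forall>\<delta>\<in>S. I \<delta> = generated_ideal (C \<delta>)
        {{\<gamma> \<in> C \<delta>. \<gamma> \<in> acc_pts (C \<delta>) \<or> cf \<gamma> < \<alpha> \<or> \<gamma> < \<beta>} | \<alpha> \<beta>. \<alpha> < \<mu> \<and> \<beta> < \<delta>}) \<and>
     (\<forall>E. club_in UNIV E \<longrightarrow> stationary {\<delta> \<in> S. E \<inter> C \<delta> \<notin> I \<delta>})"

definition id_p :: "'a::wellorder set \<Rightarrow> ('a \<Rightarrow> 'a set) \<Rightarrow> ('a \<Rightarrow> 'a set set) \<Rightarrow> 'a set set" where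
  "id_p S C I = {A. \<exists>E. club_in UNIV E \<and> (\<forall>\<delta>\<in>S \<inter> E. E \<inter> A \<inter> C \<delta> \<in> I \<delta>)}"

definition C_sequence :: "('a::wellorder \<Rightarrow> 'a set) \<Rightarrow> bool" where
  "C_sequence e \<longleftrightarrow>
     (\<forall>\<alpha>. limit_ord \<alpha> \<longrightarrow> club_in {..<\<alpha>} (e \<alpha>)) \<and>
     (\<forall>\<alpha> \<beta>. succ_of \<beta> \<alpha> \<longrightarrow> closed_in {..<\<alpha>} (e \<alpha>) \<and> \<beta> \<in> e \<alpha>)"

definition swallows ::
  "('a::wellorder \<Rightarrow> 'a set) \<Rightarrow> 'a set \<Rightarrow> ('a \<Rightarrow> 'a set) \<Rightarrow> bool" where
  "swallows e S C \<longleftrightarrow> (\<forall>\<alpha>. \<forall>\<delta>\<in>e \<alpha> \<inter> S. C \<delta> \<subseteq> e \<alpha>)"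

text \<open>
  The set of points visited by the minimal walk from \<open>\<beta>\<close> down to \<open>\<alpha>\<close>, for \<open>\<alpha> < \<beta>\<close>.
\<close>

inductive_set tr :: "('a::wellorder \<Rightarrow> 'a set) \<Rightarrow> 'a \<Rightarrow> 'a \<Rightarrow> 'a set"
  for e :: "'a \<Rightarrow> 'a set" and \<alpha> \<beta> :: 'a
where
  start: "\<beta> \<in> tr e \<alpha> \<beta>"
| step: "\<gamma> \<in> tr e \<alpha> \<beta> \<Longrightarrow> \<alpha> < \<gamma> \<Longrightarrow> (LEAST x. x \<in> e \<gamma> - {..<\<alpha>}) \<in> tr e \<alpha> \<beta>"

definition trace_filter :: "('a::wellorder \<Rightarrow> 'a set) \<Rightarrow> 'a filter" where
  "trace_filter e =
     (INF A\<in>{A. unbounded_in UNIV A}. principal (\<Union>{tr e \<alpha> \<beta> | \<alpha> \<beta>. \<alpha> \<in> A \<and> \<beta> \<in> A \<and> \<alpha> < \<beta>}))"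

definition filter_sets :: "'a filter \<Rightarrow> 'a set set" where
  "filter_sets F = {X. \<forall>\<^sub>F x in F. x \<in> X}"

definition uniform_filter :: "'a filter \<Rightarrow> bool" where
  "uniform_filter F \<longleftrightarrow> (\<forall>X\<in>filter_sets F. |X| =o |UNIV::'a set| )"

end

theory Submission
  imports Defs
begin

text \<open>
  The complement of each generator of the trace filter lies in \<open>id_p\<close>.
  Given an unbounded \<open>A\<close>, let \<open>E\<close> be the club of limit points of \<open>A\<close>, let \<open>\<delta> \<in> S \<inter> E\<close>, and
  pick \<open>\<beta> \<in> A\<close> above \<open>\<delta>\<close>. All walks from \<open>\<beta>\<close> to a sufficiently large \<open>\<alpha> < \<delta>\<close> pass through the
  same \<open>\<eta>\<close> with \<open>\<delta> \<in> e \<eta>\<close>, hence \<open>C \<delta> \<subseteq> e \<eta>\<close> by swallowing. If \<open>\<gamma> \<in> E \<inter> C \<delta>\<close> is large and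
  \<open>cf \<gamma>\<close> exceeds the cardinality of \<open>e \<eta>\<close>, then \<open>e \<eta>\<close> is bounded below \<open>\<gamma>\<close>, so the walk to any
  \<open>\<alpha> \<in> A \<inter> \<gamma>\<close> beyond that bound steps from \<open>\<eta>\<close> to \<open>\<gamma>\<close>. As \<open>id_p\<close> is an ideal, proper by goodness
  of the pair, the trace filter is contained in its dual filter; and \<open>id_p\<close> contains the
  nonstationary ideal.
\<close>

section \<open>Limits and clubs\<close>

lemma limit_ordI:
  assumes "x < \<gamma>" and "\<And>x. x < \<gamma> \<Longrightarrow> \<exists>y>x. y < \<gamma>"
  shows "limit_ord \<gamma>"
  unfolding limit_ord_def succ_of_def
proof (intro conjI notI)
  assume "{..<\<gamma>} = {}" then show False using assms(1) by blast
next
  assume "\<exists>\<beta>. {..<\<gamma>} = {..\<beta>}"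
  then obtain \<beta> where b: "{..<\<gamma>} = {..\<beta>}" by blast
  then have "\<beta> < \<gamma>" by blast
  with assms(2) obtain y where "y > \<beta>" "y < \<gamma>" by blast
  with b show False by (metis atMost_iff lessThan_iff not_less)
qed

lemma limit_ord_gt:
  assumes "limit_ord \<gamma>" and "x < \<gamma>"
  shows "\<exists>y>x. y < \<gamma>"
proof (rule ccontr)
  assume "\<not> ?thesis"
  then have "{..<\<gamma>} = {..x}" using assms(2) by (auto simp: not_less)
  then show False using assms(1) unfolding limit_ord_def succ_of_def by blast
qed

text \<open>Turns the supremum inside \<open>closed_in\<close> into cofinality below \<gamma>, the
  form in which closedness is handled from here on.\<close>

lemma ord_sup_Int_eq_iff:
  assumes "limit_ord \<gamma>"
  shows "ord_sup (A \<inter> {..<\<gamma>}) = \<gamma> \<longleftrightarrow> (\<forall>x<\<gamma>. \<exists>a\<in>A. x < a \<and> a < \<gamma>)"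
proof
  assume s: "ord_sup (A \<inter> {..<\<gamma>}) = \<gamma>"
  show "\<forall>x<\<gamma>. \<exists>a\<in>A. x < a \<and> a < \<gamma>"
  proof (intro allI impI)
    fix x assume "x < \<gamma>"
    then have "\<not> (\<forall>a\<in>A \<inter> {..<\<gamma>}. a \<le> x)"
      using s not_less_Least[of x "\<lambda>x. \<forall>a\<in>A \<inter> {..<\<gamma>}. a \<le> x"] unfolding ord_sup_def by simp
    then show "\<exists>a\<in>A. x < a \<and> a < \<gamma>" by (auto simp: not_le)
  qed
next
  assume u: "\<forall>x<\<gamma>. \<exists>a\<in>A. x < a \<and> a < \<gamma>"
  show "ord_sup (A \<inter> {..<\<gamma>}) = \<gamma>"
    unfolding ord_sup_def
  proof (rule Least_equality)
    fix y assume "\<forall>a\<in>A \<inter> {..<\<gamma>}. a \<le> y"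
    with u show "\<gamma> \<le> y" by (metis IntI leD leI lessThan_iff)
  qed auto
qed

lemma closed_inD:
  assumes "closed_in D A" and "\<gamma> \<in> D" and "limit_ord \<gamma>" and "\<gamma> \<notin> A"
  shows "\<exists>x<\<gamma>. \<forall>a\<in>A. a < \<gamma> \<longrightarrow> a \<le> x"
  using assms ord_sup_Int_eq_iff[OF assms(3), of A] unfolding closed_in_def
  by (meson not_le)

lemma closed_in_UNIV_iff:
  "closed_in UNIV A \<longleftrightarrow>
     (\<forall>\<gamma>. limit_ord \<gamma> \<longrightarrow> (\<forall>x<\<gamma>. \<exists>a\<in>A. x < a \<and> a < \<gamma>) \<longrightarrow> \<gamma> \<in> A)"
  unfolding closed_in_def by (auto simp: ord_sup_Int_eq_iff)

text \<open>Hypothesis \<open>bdd\<close> expresses that \<lambda> has uncountable cofinality. It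
  bounds the iterates of \<open>g\<close> from \<open>x\<close>, and their supremum is the closure
  point. Both unboundedness proofs for clubs below apply this to a suitable
  \<open>g\<close>.\<close>

lemma ex_limit_closure_point:
  fixes g :: "'a::wellorder \<Rightarrow> 'a"
  assumes bdd: "\<And>f::nat \<Rightarrow> 'a. \<exists>b. \<forall>n. f n < b" and g: "\<And>x. x < g x"
  shows "\<exists>\<delta>>x. limit_ord \<delta> \<and> (\<forall>y<\<delta>. \<exists>z\<ge>y. g z < \<delta>)"
proof -
  define f where "f n = (g ^^ n) x" for n
  define \<delta> where "\<delta> = (LEAST b. \<forall>n. f n < b)"
  have lt: "f n < \<delta>" for n
    using LeastI_ex[OF bdd[of f]] unfolding \<delta>_def by blast
  have step: "f (Suc n) = g (f n)" for n by (simp add: f_def)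
  have ex: "\<exists>n. y \<le> f n" if "y < \<delta>" for y
    using not_less_Least[of y "\<lambda>b. \<forall>n. f n < b"] that unfolding \<delta>_def by (auto simp: not_less)
  have cl: "\<exists>z\<ge>y. g z < \<delta>" if "y < \<delta>" for y
    using ex[OF that] lt step by metis
  have x: "x < \<delta>" using lt[of 0] by (simp add: f_def)
  moreover have "limit_ord \<delta>"
    using x cl g by (intro limit_ordI[of x]) (assumption, meson le_less_trans)
  ultimately show ?thesis using cl by blast
qed

lemma unbounded_in_UNIV_gt:
  fixes A :: "'a::wellorder set"
  assumes bdd: "\<And>f::nat \<Rightarrow> 'a. \<exists>b. \<forall>n. f n < b" and "unbounded_in UNIV A"
  shows "\<exists>a\<in>A. x < a"
proof -
  \<comment> \<open>A constant sequence has a strict bound, so \<lambda> has no largest element;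
    this upgrades \<le> to <.\<close>
  obtain y where "x < y" using bdd[of "\<lambda>_. x"] by blast
  with assms(2) show ?thesis unfolding unbounded_in_def by (meson UNIV_I less_le_trans)
qed

text \<open>Unboundedness comes from a function \<open>g\<close> choosing larger elements of
  \<open>A\<close>: its closure points are limits of \<open>A\<close>.\<close>

lemma club_in_limit_points:
  fixes A :: "'a::wellorder set"
  assumes bdd: "\<And>f::nat \<Rightarrow> 'a. \<exists>b. \<forall>n. f n < b" and A: "unbounded_in UNIV A"
  shows "club_in UNIV {\<delta>. limit_ord \<delta> \<and> (\<forall>x<\<delta>. \<exists>a\<in>A. x < a \<and> a < \<delta>)}" (is "club_in _ ?E")
  unfolding club_in_def closed_in_UNIV_iff
proof (intro conjI allI impI)
  fix \<gamma> assume "limit_ord \<gamma>" "\<forall>x<\<gamma>. \<exists>a\<in>?E. x < a \<and> a < \<gamma>"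
  then show "\<gamma> \<in> ?E" by (auto, meson less_trans)
next
  obtain g where g: "\<And>x. g x \<in> A" "\<And>x. x < g x"
    using unbounded_in_UNIV_gt[OF bdd A] by metis
  have "\<exists>\<delta>\<in>?E. x \<le> \<delta>" for x
  proof -
    obtain \<delta> where d: "x < \<delta>" "limit_ord \<delta>" "\<forall>y<\<delta>. \<exists>z\<ge>y. g z < \<delta>"
      using ex_limit_closure_point[OF bdd, of g x] g(2) by blast
    then have "\<delta> \<in> ?E" using g by (auto, meson le_less_trans)
    then show ?thesis using d(1) less_imp_le by blast
  qed
  then show "unbounded_in UNIV ?E" unfolding unbounded_in_def by blast
qed

lemma club_in_Int:
  fixes E F :: "'a::wellorder set"
  assumes bdd: "\<And>f::nat \<Rightarrow> 'a. \<exists>b. \<forall>n. f n < b" and E: "club_in UNIV E" and F: "club_in UNIV F"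
  shows "club_in UNIV (E \<inter> F)"
proof -
  have cE: "closed_in UNIV E" and cF: "closed_in UNIV F"
    and uE: "unbounded_in UNIV E" and uF: "unbounded_in UNIV F"
    using E F by (auto simp: club_in_def)
  obtain g where g: "\<And>x. g x \<in> E" "\<And>x. x < g x"
    using unbounded_in_UNIV_gt[OF bdd uE] by metis
  obtain h where h: "\<And>x. h x \<in> F" "\<And>x. x < h x"
    using unbounded_in_UNIV_gt[OF bdd uF] by metis
  have "\<exists>\<delta>\<in>E \<inter> F. x \<le> \<delta>" for x
  proof -
    \<comment> \<open>Composing the two choices interleaves elements of \<open>E\<close> and
      \<open>F\<close>, so a closure point is a limit of both and lies in both by
      closedness.\<close>
    have "y < h (g y)" for y using g(2) h(2) less_trans by blast
    then obtain \<delta> where d: "x < \<delta>" "limit_ord \<delta>" "\<forall>y<\<delta>. \<exists>z\<ge>y. h (g z) < \<delta>"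
      using ex_limit_closure_point[OF bdd, of "\<lambda>y. h (g y)" x] by blast
    have "\<forall>y<\<delta>. \<exists>a\<in>E. y < a \<and> a < \<delta>"
      using d(3) g h(2) by (meson le_less_trans less_trans)
    moreover have "\<forall>y<\<delta>. \<exists>a\<in>F. y < a \<and> a < \<delta>"
      using d(3) g(2) h by (meson le_less_trans less_trans)
    ultimately have "\<delta> \<in> E \<inter> F" using d(2) cE cF unfolding closed_in_UNIV_iff by blast
    then show ?thesis using d(1) less_imp_le by blast
  qed
  moreover have "closed_in UNIV (E \<inter> F)"
    unfolding closed_in_UNIV_iff
  proof (intro allI impI IntI)
    fix \<gamma> assume "limit_ord \<gamma>" and "\<forall>x<\<gamma>. \<exists>a\<in>E \<inter> F. x < a \<and> a < \<gamma>"
    then show "\<gamma> \<in> E" "\<gamma> \<in> F" using cE cF unfolding closed_in_UNIV_iff by blast+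
  qed
  ultimately show ?thesis unfolding club_in_def unbounded_in_def by blast
qed

text \<open>The final segment above \<open>b\<close> is a club, so it meets every stationary
  set.\<close>

lemma stationary_gt:
  fixes X :: "'a::wellorder set"
  assumes bdd: "\<And>f::nat \<Rightarrow> 'a. \<exists>b. \<forall>n. f n < b" and "stationary X"
  shows "\<exists>x\<in>X. b < x"
proof -
  have "club_in UNIV {b<..}"
    unfolding club_in_def closed_in_UNIV_iff
  proof (intro conjI allI impI)
    fix \<gamma> assume "limit_ord \<gamma>" "\<forall>x<\<gamma>. \<exists>a\<in>{b<..}. x < a \<and> a < \<gamma>"
    moreover from this(1) obtain x where "x < \<gamma>" unfolding limit_ord_def by blast
    ultimately show "\<gamma> \<in> {b<..}" by (auto intro: less_trans)
  next
    have "\<exists>a\<in>{b<..}. x \<le> a" for x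
    proof -
      obtain y where "max b x < y" using bdd[of "\<lambda>_. max b x"] by blast
      then show ?thesis by (intro bexI[of _ y]) auto
    qed
    then show "unbounded_in UNIV {b<..}" unfolding unbounded_in_def by blast
  qed
  then show ?thesis using assms(2) unfolding stationary_def by fastforce
qed

section \<open>Cardinalities of initial segments\<close>

text \<open>A cardinal smaller than a well-order is isomorphic to one of its proper initial
  segments. The well-order used is \<lambda> cut off at \<open>x\<close>, whose proper initial
  segments are the sets \<open>{..<y}\<close>.\<close>

lemma card_of_ordLess_lessThan:
  fixes x :: "'a::wellorder"
  assumes "|B| <o |{..<x}|"
  shows "\<exists>y<x. |B| =o |{..<y}|"
proof -
  define r where "r = {(a, b). a \<le> b \<and> b < x}"
  have F: "Field r = {..<x}" unfolding r_def Field_def by (auto intro: le_less_trans)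
  have lin: "Linear_order r"
    unfolding order_on_defs F refl_on_def trans_def antisym_def total_on_def r_def
    by (auto simp: F[symmetric] Field_def)
  have "wf (r - Id)"
    by (rule wf_subset[OF wf]) (auto simp: r_def)
  then have W: "Well_order r" using lin unfolding well_order_on_def by blast
  \<comment> \<open>The cardinal of a set is least among the well-orders of that set.\<close>
  have "|B| <o r"
    using assms card_of_least[of "{..<x}" r] W F ordLess_ordLeq_trans by metis
  then obtain a where a: "a \<in> Field r" "|B| =o Restr r (underS r a)"
    using ordLess_iff_ordIso_Restr[OF W card_of_Well_order] by blast
  have "Field (Restr r (underS r a)) = {..<a}"
    using a(1) unfolding F by (auto simp: Field_def underS_def r_def)
  then have "|B| =o |{..<a}|"
    using card_of_cong[OF a(2)] by (simp add: Field_card_of)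
  then show ?thesis using a(1) F by blast
qed

text \<open>Since \<open>cf\<close> minimizes over exact cardinalities, \<kappa> is first lowered to
  some \<open>y\<close> whose cardinality is that of \<open>A\<close>.\<close>

lemma cf_le:
  fixes \<gamma> \<kappa> :: "'a::wellorder"
  assumes "unbounded_in {..<\<gamma>} A" and "|A| \<le>o |{..<\<kappa>}|"
  shows "cf \<gamma> \<le> \<kappa>"
proof -
  obtain y where y: "y \<le> \<kappa>" "|A| =o |{..<y}|"
    using assms(2) card_of_ordLess_lessThan[of A \<kappa>] ordLeq_iff_ordLess_or_ordIso
    by (metis less_imp_le order_refl)
  then have "cf \<gamma> \<le> y" unfolding cf_def using assms(1) by (intro Least_le) blast
  then show ?thesis using y(1) by simp
qed

lemma infinite_cardinal_gt:
  fixes \<mu> :: "'a::wellorder"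
  assumes inf: "infinite {..<\<mu>}" and card: "\<forall>\<alpha><\<mu>. |{..<\<alpha>}| <o |{..<\<mu>}|" and "\<alpha> < \<mu>"
  shows "\<exists>\<beta>>\<alpha>. \<beta> < \<mu>"
proof (rule ccontr)
  assume "\<not> ?thesis"
  \<comment> \<open>Here \<alpha> would be the largest element of \<mu>, but removing one point from
    an infinite set preserves its cardinality.\<close>
  then have eq: "{..<\<mu>} = insert \<alpha> {..<\<alpha>}" using \<open>\<alpha> < \<mu>\<close> by (auto simp: not_less order_le_less)
  then have "infinite {..<\<alpha>}" using inf by simp
  then have "|insert \<alpha> {..<\<alpha>}| =o |{..<\<alpha>}|"
    using infinite_imp_bij_betw2[of "{..<\<alpha>}" \<alpha>] card_of_ordIso ordIso_symmetric by fastforce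
  with card \<open>\<alpha> < \<mu>\<close> eq show False by (metis not_ordLess_ordIso ordIso_symmetric)
qed

text \<open>An infinite successor cardinal is regular, so a set not of full size is not cofinal in
  \<lambda>; the absence of a largest element makes its bound strict.\<close>

lemma cardSuc_type_regular:
  fixes \<mu> :: "'a::wellorder" and K :: "'a set"
  assumes inf: "infinite {..<\<mu>}" and succ: "succ_cardinal_type \<mu>"
  shows "\<not> |K| =o |UNIV::'a set| \<Longrightarrow> \<exists>c. \<forall>x\<in>K. x < c"
    and "|{..<\<mu>}| <o |UNIV::'a set|"
proof -
  define r where "r = {(x, y). x \<le> (y::'a)}"
  define s where "s = cardSuc |{..<\<mu>}|"
  have rs: "r =o s" using succ unfolding r_def s_def succ_cardinal_type_def .
  have F: "Field r = UNIV" unfolding r_def Field_def by auto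
  have cs: "Card_order s" unfolding s_def by (simp add: cardSuc_Card_order card_of_Card_order)
  have cr: "Card_order r" using Card_order_ordIso[OF cs rs] .
  have infs: "infinite (Field s)"
    unfolding s_def using cardSuc_finite[OF card_of_Card_order, of "{..<\<mu>}"] inf Field_card_of by metis
  have ir: "infinite (Field r)"
    using card_of_ordIso_finite[OF card_of_cong[OF rs]] infs by simp
  have "regularCard s"
    unfolding s_def by (rule infinite_cardSuc_regularCard) (simp_all add: inf Field_card_of card_of_Card_order card_of_card_order_on)
  \<comment> \<open>Regularity is carried along the order isomorphism in the equivalent form of
    stability.\<close>
  then have "regularCard r"
    using stable_regularCard[OF cr ir] stable_ordIso1[OF _ rs] regularCard_stable[OF cs infs] by blast
  then have reg: "|K| =o r" if "cofinal K r" for K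
    using that F unfolding regularCard_def by blast
  have Ur: "|UNIV::'a set| =o r" using card_of_Field_ordIso[OF cr] F by simp
  have nomax: "\<exists>c. b < c" for b :: 'a
    using infinite_Card_order_limit[OF cr ir, of b] F unfolding r_def by (auto simp: order_le_less)
  show "\<exists>c. \<forall>x\<in>K. x < c" if "\<not> |K| =o |UNIV::'a set|"
  proof -
    have "\<not> cofinal K r" using that reg Ur ordIso_symmetric ordIso_transitive by blast
    then have "\<exists>b. \<forall>x\<in>K. x \<le> b" unfolding cofinal_def F r_def by auto (metis not_le less_le)
    then show ?thesis using nomax by (meson le_less_trans)
  qed
  have "|{..<\<mu>}| <o s" unfolding s_def by (simp add: cardSuc_greater card_of_Card_order)
  then show "|{..<\<mu>}| <o |UNIV::'a set|"
    using Ur rs ordIso_symmetric ordIso_transitive ordLess_ordIso_trans by blast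
qed

section \<open>Minimal walks\<close>

text \<open>A step depends only on the current point and the target, so a walk passing through
  \<gamma> continues as the walk that starts there.\<close>

lemma tr_trans:
  assumes "\<gamma> \<in> tr e \<alpha> \<beta>" and "\<eta> \<in> tr e \<alpha> \<gamma>"
  shows "\<eta> \<in> tr e \<alpha> \<beta>"
  using assms(2,1) by induction (blast intro: tr.step)+

lemma C_sequenceD:
  assumes "C_sequence e" and "\<delta> < \<beta>"
  shows "e \<beta> \<subseteq> {..<\<beta>}" and "closed_in {..<\<beta>} (e \<beta>)" and "\<exists>x\<in>e \<beta>. \<delta> \<le> x"
proof -
  have "closed_in {..<\<beta>} (e \<beta>) \<and> (\<exists>x\<in>e \<beta>. \<delta> \<le> x)"
  proof (cases "limit_ord \<beta>")
    case True
    then show ?thesis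
      using assms unfolding C_sequence_def club_in_def unbounded_in_def by blast
  next
    case False
    \<comment> \<open>As \<beta> exceeds \<delta> it is not zero, so it is a successor; its
      predecessor is the required element.\<close>
    then obtain \<rho> where r: "succ_of \<rho> \<beta>" using assms(2) unfolding limit_ord_def by blast
    then have "\<delta> \<le> \<rho>" using assms(2) unfolding succ_of_def by blast
    then show ?thesis using r assms(1) unfolding C_sequence_def by blast
  qed
  then show "e \<beta> \<subseteq> {..<\<beta>}" "closed_in {..<\<beta>} (e \<beta>)" "\<exists>x\<in>e \<beta>. \<delta> \<le> x"
    unfolding closed_in_def by auto
qed

text \<open>The point \<eta> is the last stop before \<delta> on the walk from \<beta> to \<delta>.
  At an earlier stop the closed set \<open>e \<beta>\<close> omits the limit \<delta>, hence is
  bounded below \<delta>, and all targets between that bound and \<delta> give the same step.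
  Induction on \<beta> collects the maximum of these bounds.\<close>

lemma walk_stabilizes:
  fixes \<beta> \<delta> :: "'a::wellorder"
  assumes e: "C_sequence e" and lim: "limit_ord \<delta>" and "\<delta> < \<beta>"
  shows "\<exists>\<eta> \<xi>. \<delta> < \<eta> \<and> \<delta> \<in> e \<eta> \<and> \<xi> < \<delta> \<and> (\<forall>\<alpha>. \<xi> < \<alpha> \<longrightarrow> \<alpha> \<le> \<delta> \<longrightarrow> \<eta> \<in> tr e \<alpha> \<beta>)"
  using \<open>\<delta> < \<beta>\<close>
proof (induction \<beta> rule: less_induct)
  case (less \<beta>)
  show ?case
  proof (cases "\<delta> \<in> e \<beta>")
    case True
    obtain \<xi> where "\<xi> < \<delta>" using lim unfolding limit_ord_def by blast
    then show ?thesis using True less.prems tr.start by blast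
  next
    case False
    note eb = C_sequenceD[OF e less.prems]
    define \<beta>' where "\<beta>' = (LEAST x. x \<in> e \<beta> - {..<\<delta>})"
    have "\<exists>x. x \<in> e \<beta> - {..<\<delta>}" using eb(3) by (auto simp: not_less)
    then have b': "\<beta>' \<in> e \<beta> - {..<\<delta>}" unfolding \<beta>'_def by (rule LeastI_ex)
    then have lt: "\<beta>' < \<beta>" "\<delta> < \<beta>'" using eb(1) False by (auto simp: not_less order_le_less)
    obtain \<xi> where x: "\<xi> < \<delta>" "\<forall>a\<in>e \<beta>. a < \<delta> \<longrightarrow> a \<le> \<xi>"
      using closed_inD[OF eb(2) _ lim False] less.prems by blast
    obtain \<eta> \<xi>' where h: "\<delta> < \<eta>" "\<delta> \<in> e \<eta>" "\<xi>' < \<delta>"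
      "\<forall>\<alpha>. \<xi>' < \<alpha> \<longrightarrow> \<alpha> \<le> \<delta> \<longrightarrow> \<eta> \<in> tr e \<alpha> \<beta>'"
      using less.IH[OF lt] by blast
    have "\<eta> \<in> tr e \<alpha> \<beta>" if "max \<xi> \<xi>' < \<alpha>" "\<alpha> \<le> \<delta>" for \<alpha>
    proof -
      \<comment> \<open>Elements of \<open>e \<beta>\<close> below \<delta> are at most \<xi>, hence
        below \<alpha>, so the minima above \<alpha> and above \<delta> agree.\<close>
      have "e \<beta> - {..<\<alpha>} = e \<beta> - {..<\<delta>}" using x(2) that by force
      then have "\<beta>' \<in> tr e \<alpha> \<beta>"
        using tr.step[OF tr.start, of \<alpha> \<beta> e] that less.prems unfolding \<beta>'_def by auto
      moreover have "\<eta> \<in> tr e \<alpha> \<beta>'" using h(4) that by simp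
      ultimately show ?thesis by (rule tr_trans)
    qed
    moreover have "max \<xi> \<xi>' < \<delta>" using x h by simp
    ultimately show ?thesis using h by blast
  qed
qed

section \<open>The ideal \<open>id_p\<close>\<close>

lemma generated_ideal_mono: "A \<in> generated_ideal X G \<Longrightarrow> B \<subseteq> A \<Longrightarrow> B \<in> generated_ideal X G"
  unfolding generated_ideal_def by blast

lemma generated_ideal_empty: "{} \<in> generated_ideal X G"
  unfolding generated_ideal_def by blast

lemma generated_ideal_Un:
  assumes "A \<in> generated_ideal X G" and "B \<in> generated_ideal X G"
  shows "A \<union> B \<in> generated_ideal X G"
proof -
  obtain F H where "finite F" "F \<subseteq> G" "A \<subseteq> \<Union>F" "finite H" "H \<subseteq> G" "B \<subseteq> \<Union>H" "A \<subseteq> X" "B \<subseteq> X"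
    using assms unfolding generated_ideal_def by blast
  then have "finite (F \<union> H) \<and> F \<union> H \<subseteq> G \<and> A \<union> B \<subseteq> \<Union>(F \<union> H)" by blast
  then show ?thesis using \<open>A \<subseteq> X\<close> \<open>B \<subseteq> X\<close> unfolding generated_ideal_def by blast
qed

lemma good_pair_ideal:
  assumes "good_pair \<mu> S C I" and "\<delta> \<in> S"
  shows "I \<delta> = generated_ideal (C \<delta>)
    {{\<gamma> \<in> C \<delta>. \<gamma> \<in> acc_pts (C \<delta>) \<or> cf \<gamma> < \<alpha> \<or> \<gamma> < \<beta>} | \<alpha> \<beta>. \<alpha> < \<mu> \<and> \<beta> < \<delta>}"
  using assms unfolding good_pair_def by blast

lemma id_p_mono:
  assumes gp: "good_pair \<mu> S C I" and "A \<in> id_p S C I" and "B \<subseteq> A"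
  shows "B \<in> id_p S C I"
proof -
  obtain E where E: "club_in UNIV E" "\<forall>\<delta>\<in>S \<inter> E. E \<inter> A \<inter> C \<delta> \<in> I \<delta>"
    using assms(2) unfolding id_p_def by blast
  have "E \<inter> B \<inter> C \<delta> \<in> I \<delta>" if "\<delta> \<in> S \<inter> E" for \<delta>
  proof -
    have d: "\<delta> \<in> S" and sub: "E \<inter> B \<inter> C \<delta> \<subseteq> E \<inter> A \<inter> C \<delta>" using that assms(3) by auto
    have "E \<inter> A \<inter> C \<delta> \<in> I \<delta>" using E(2) that by blast
    then show ?thesis using sub unfolding good_pair_ideal[OF gp d] by (rule generated_ideal_mono)
  qed
  then show ?thesis using E(1) unfolding id_p_def by blast
qed

text \<open>Intersect the witnessing clubs: fewer \<delta> have to be checked, and at each the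
  relevant set is covered by two members of \<open>I \<delta>\<close>.\<close>

lemma id_p_Un:
  fixes A B :: "'a::wellorder set"
  assumes bdd: "\<And>f::nat \<Rightarrow> 'a. \<exists>b. \<forall>n. f n < b" and gp: "good_pair \<mu> S C I"
    and "A \<in> id_p S C I" and "B \<in> id_p S C I"
  shows "A \<union> B \<in> id_p S C I"
proof -
  obtain E F where E: "club_in UNIV E" "\<forall>\<delta>\<in>S \<inter> E. E \<inter> A \<inter> C \<delta> \<in> I \<delta>"
    and F: "club_in UNIV F" "\<forall>\<delta>\<in>S \<inter> F. F \<inter> B \<inter> C \<delta> \<in> I \<delta>"
    using assms(3,4) unfolding id_p_def by blast
  have "(E \<inter> F) \<inter> (A \<union> B) \<inter> C \<delta> \<in> I \<delta>" if "\<delta> \<in> S \<inter> (E \<inter> F)" for \<delta>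
  proof -
    have d: "\<delta> \<in> S" using that by blast
    have "E \<inter> A \<inter> C \<delta> \<in> I \<delta>" "F \<inter> B \<inter> C \<delta> \<in> I \<delta>" using E F that by auto
    then have "(E \<inter> A \<inter> C \<delta>) \<union> (F \<inter> B \<inter> C \<delta>) \<in> I \<delta>"
      unfolding good_pair_ideal[OF gp d] by (rule generated_ideal_Un)
    moreover have "(E \<inter> F) \<inter> (A \<union> B) \<inter> C \<delta> \<subseteq> (E \<inter> A \<inter> C \<delta>) \<union> (F \<inter> B \<inter> C \<delta>)" by blast
    ultimately show ?thesis unfolding good_pair_ideal[OF gp d] by (rule generated_ideal_mono)
  qed
  then show ?thesis using club_in_Int[OF bdd E(1) F(1)] unfolding id_p_def by blast
qed

text \<open>A club disjoint from \<open>A\<close> makes every set to be tested empty.\<close>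

lemma nonstationary_ideal_subset_id_p:
  fixes S :: "'a::wellorder set"
  assumes gp: "good_pair \<mu> S C I"
  shows "nonstationary_ideal \<subseteq> id_p S C I"
proof
  fix A :: "'a set" assume "A \<in> nonstationary_ideal"
  then obtain E where E: "club_in UNIV E" "A \<inter> E = {}"
    unfolding nonstationary_ideal_def stationary_def by blast
  have "E \<inter> A \<inter> C \<delta> \<in> I \<delta>" if "\<delta> \<in> S \<inter> E" for \<delta>
  proof -
    have "E \<inter> A \<inter> C \<delta> = {}" using E(2) by blast
    then show ?thesis using good_pair_ideal[OF gp, of \<delta>] that generated_ideal_empty by simp
  qed
  then show "A \<in> id_p S C I" using E(1) unfolding id_p_def by blast
qed

text \<open>A witnessing club \<open>E\<close> would be disjoint from the set of \<delta> with
  \<open>E \<inter> C \<delta>\<close> outside \<open>I \<delta>\<close>, which goodness makes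
  stationary.\<close>

lemma UNIV_notin_id_p:
  assumes "good_pair \<mu> S C I"
  shows "UNIV \<notin> id_p S C I"
proof
  assume "UNIV \<in> id_p S C I"
  then obtain E where E: "club_in UNIV E" "\<forall>\<delta>\<in>S \<inter> E. E \<inter> C \<delta> \<in> I \<delta>"
    unfolding id_p_def by auto
  then have "stationary {\<delta> \<in> S. E \<inter> C \<delta> \<notin> I \<delta>}" using assms unfolding good_pair_def by blast
  then show False using E unfolding stationary_def by blast
qed

section \<open>The trace filter\<close>

abbreviation trace_set :: "('a::wellorder \<Rightarrow> 'a set) \<Rightarrow> 'a set \<Rightarrow> 'a set" where
  "trace_set e A \<equiv> \<Union>{tr e \<alpha> \<beta> | \<alpha> \<beta>. \<alpha> \<in> A \<and> \<beta> \<in> A \<and> \<alpha> < \<beta>}"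

lemma limit_point_in_trace:
  assumes g: "\<gamma> \<in> e \<eta>" "\<forall>x<\<gamma>. \<exists>a\<in>A. x < a \<and> a < \<gamma>"
    and k: "|e \<eta>| \<le>o |{..<\<kappa>}|" "\<kappa> < cf \<gamma>"
    and x: "\<xi> < \<gamma>" "\<And>\<alpha>. \<xi> < \<alpha> \<Longrightarrow> \<alpha> < \<gamma> \<Longrightarrow> \<eta> \<in> tr e \<alpha> \<beta>" and "\<gamma> < \<eta>"
  shows "\<exists>\<alpha>\<in>A. \<alpha> < \<gamma> \<and> \<gamma> \<in> tr e \<alpha> \<beta>"
proof -
  have "|e \<eta> \<inter> {..<\<gamma>}| \<le>o |{..<\<kappa>}|"
    using card_of_mono1[of "e \<eta> \<inter> {..<\<gamma>}" "e \<eta>"] k(1) ordLeq_transitive by blast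
  \<comment> \<open>A set of size at most \<kappa> is too small to be cofinal in \<gamma>.\<close>
  then have "\<not> unbounded_in {..<\<gamma>} (e \<eta> \<inter> {..<\<gamma>})" using cf_le k(2) by (meson not_le)
  then obtain y where y: "y < \<gamma>" "\<forall>a\<in>e \<eta>. a < \<gamma> \<longrightarrow> a < y"
    unfolding unbounded_in_def by (auto simp: not_le)
  obtain \<alpha> where a: "\<alpha> \<in> A" "max \<xi> y < \<alpha>" "\<alpha> < \<gamma>" using g(2) x(1) y(1) by (metis max_less_iff_conj)
  \<comment> \<open>From \<open>y\<close> on, \<open>e \<eta>\<close> has no points below \<gamma>,
    so its least element not below \<alpha> is \<gamma> itself.\<close>
  have "(LEAST z. z \<in> e \<eta> - {..<\<alpha>}) = \<gamma>"
  proof (rule Least_equality)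
    show "\<gamma> \<in> e \<eta> - {..<\<alpha>}" using g(1) a by auto
    fix z assume "z \<in> e \<eta> - {..<\<alpha>}" then show "\<gamma> \<le> z" using y(2) a(2) by (force simp: not_less)
  qed
  moreover have "\<eta> \<in> tr e \<alpha> \<beta>" using x(2) a by simp
  ultimately have "\<gamma> \<in> tr e \<alpha> \<beta>" using tr.step[of \<eta> e \<alpha> \<beta>] a(3) \<open>\<gamma> < \<eta>\<close> by simp
  then show ?thesis using a by blast
qed

lemma Compl_trace_set_in_id_p:
  fixes \<mu> :: "'a::wellorder"
  assumes bdd: "\<And>f::nat \<Rightarrow> 'a. \<exists>b. \<forall>n. f n < b"
    and inf: "infinite {..<\<mu>}" and card: "\<forall>\<alpha><\<mu>. |{..<\<alpha>}| <o |{..<\<mu>}|"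
    and gp: "good_pair \<mu> S C I" and e: "C_sequence e" and small: "\<forall>\<alpha>. |e \<alpha>| <o |{..<\<mu>}|"
    and sw: "swallows e S C" and A: "unbounded_in UNIV A"
  shows "- trace_set e A \<in> id_p S C I"
proof -
  define E where "E = {\<delta>. limit_ord \<delta> \<and> (\<forall>x<\<delta>. \<exists>a\<in>A. x < a \<and> a < \<delta>)}"
  have "E \<inter> - trace_set e A \<inter> C \<delta> \<in> I \<delta>" if d: "\<delta> \<in> S \<inter> E" for \<delta>
  proof -
    have dS: "\<delta> \<in> S" and lim: "limit_ord \<delta>" using d E_def by auto
    obtain \<beta> where b: "\<beta> \<in> A" "\<delta> < \<beta>" using unbounded_in_UNIV_gt[OF bdd A] by blast
    obtain \<eta> \<xi> where h: "\<delta> < \<eta>" "\<delta> \<in> e \<eta>" "\<xi> < \<delta>"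
      "\<forall>\<alpha>. \<xi> < \<alpha> \<longrightarrow> \<alpha> \<le> \<delta> \<longrightarrow> \<eta> \<in> tr e \<alpha> \<beta>"
      using walk_stabilizes[OF e lim b(2)] by blast
    have sub: "C \<delta> \<subseteq> e \<eta>" using sw h(2) d unfolding swallows_def by blast
    have Cd: "C \<delta> \<subseteq> {..<\<delta>}"
      using gp d unfolding good_pair_def club_in_def closed_in_def by blast
    obtain \<kappa> where k: "\<kappa> < \<mu>" "|e \<eta>| =o |{..<\<kappa>}|"
      using small card_of_ordLess_lessThan[of "e \<eta>" \<mu>] by blast
    \<comment> \<open>Points outside \<open>N\<close> satisfy only \<kappa>' \<le>
      \<open>cf \<gamma>\<close> and \<xi>' \<le> \<gamma>. Enlarging \<kappa> and \<xi> beforehand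
      yields the strict inequalities that \<open>limit_point_in_trace\<close> demands.\<close>
    obtain \<kappa>' where k': "\<kappa> < \<kappa>'" "\<kappa>' < \<mu>" using infinite_cardinal_gt[OF inf card k(1)] by blast
    obtain \<xi>' where x': "\<xi> < \<xi>'" "\<xi>' < \<delta>" using limit_ord_gt[OF lim h(3)] by blast
    \<comment> \<open>This is a single generator of \<open>I \<delta>\<close>, so it suffices to
      cover the set by \<open>N\<close>.\<close>
    define N where "N = {\<gamma> \<in> C \<delta>. \<gamma> \<in> acc_pts (C \<delta>) \<or> cf \<gamma> < \<kappa>' \<or> \<gamma> < \<xi>'}"
    have "E \<inter> - trace_set e A \<inter> C \<delta> \<subseteq> N"
    proof
      fix \<gamma> assume g: "\<gamma> \<in> E \<inter> - trace_set e A \<inter> C \<delta>"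
      show "\<gamma> \<in> N"
      proof (rule ccontr)
        assume "\<gamma> \<notin> N"
        then have n: "\<kappa>' \<le> cf \<gamma>" "\<xi>' \<le> \<gamma>" using g unfolding N_def by auto
        have gd: "\<gamma> < \<delta>" using g Cd by blast
        have "\<exists>\<alpha>\<in>A. \<alpha> < \<gamma> \<and> \<gamma> \<in> tr e \<alpha> \<beta>"
        proof (rule limit_point_in_trace)
          show "\<gamma> \<in> e \<eta>" using g sub by blast
          show "\<forall>x<\<gamma>. \<exists>a\<in>A. x < a \<and> a < \<gamma>" using g E_def by auto
          show "|e \<eta>| \<le>o |{..<\<kappa>}|" using k(2) ordIso_imp_ordLeq by blast
          show "\<kappa> < cf \<gamma>" "\<xi> < \<gamma>" "\<gamma> < \<eta>" using n k' x' gd h(1) by auto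
          show "\<eta> \<in> tr e \<alpha> \<beta>" if "\<xi> < \<alpha>" "\<alpha> < \<gamma>" for \<alpha> using h(4) that gd by auto
        qed
        then obtain \<alpha> where "\<alpha> \<in> A" "\<alpha> < \<gamma>" "\<gamma> \<in> tr e \<alpha> \<beta>" by blast
        moreover have "\<alpha> < \<beta>" using \<open>\<alpha> < \<gamma>\<close> gd b(2) by simp
        ultimately show False using g b(1) by blast
      qed
    qed
    moreover have "N \<in> I \<delta>"
    proof -
      have "N \<in> {{\<gamma> \<in> C \<delta>. \<gamma> \<in> acc_pts (C \<delta>) \<or> cf \<gamma> < \<alpha> \<or> \<gamma> < \<beta>} | \<alpha> \<beta>. \<alpha> < \<mu> \<and> \<beta> < \<delta>}"
        unfolding N_def using k'(2) x'(2) by blast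
      moreover have "N \<subseteq> C \<delta>" unfolding N_def by blast
      ultimately show ?thesis
        unfolding good_pair_ideal[OF gp dS] generated_ideal_def
        by (intro CollectI conjI exI[of _ "{N}"]) auto
    qed
    ultimately show ?thesis unfolding good_pair_ideal[OF gp dS] by (blast intro: generated_ideal_mono)
  qed
  then show ?thesis
    using club_in_limit_points[OF bdd A] unfolding id_p_def E_def[symmetric] by blast
qed

text \<open>A set in the filter contains a finite intersection of generators, so its complement is
  covered by finitely many members of the ideal.\<close>

lemma Compl_in_id_p_of_trace_filter:
  fixes X :: "'a::wellorder set"
  assumes bdd: "\<And>f::nat \<Rightarrow> 'a. \<exists>b. \<forall>n. f n < b" and gp: "good_pair \<mu> S C I"
    and gen: "\<And>A. unbounded_in UNIV A \<Longrightarrow> - trace_set e A \<in> id_p S C I"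
    and X: "X \<in> filter_sets (trace_filter e)"
  shows "- X \<in> id_p S C I"
proof -
  have "eventually (\<lambda>x. x \<in> X) (INF A\<in>{A. unbounded_in UNIV A}. principal (trace_set e A))"
    using X unfolding filter_sets_def trace_filter_def by simp
  from this[THEN eventually_INF[THEN iffD1]]
  obtain \<A> where "finite \<A>" "\<A> \<subseteq> {A. unbounded_in UNIV A}"
    and ev: "eventually (\<lambda>x. x \<in> X) (INF A\<in>\<A>. principal (trace_set e A))"
    by (elim exE conjE) (rule that)
  then have sub: "(\<Inter>A\<in>\<A>. trace_set e A) \<subseteq> X"
    by (auto simp: INF_principal_finite eventually_principal)
  have "(\<Union>A\<in>\<A>. - trace_set e A) \<in> id_p S C I"
    using \<open>finite \<A>\<close> \<open>\<A> \<subseteq> _\<close>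
  proof (induction \<A>)
    case empty
    \<comment> \<open>The empty intersection requires the empty set in \<open>id_p\<close>; it
      enters as a nonstationary set.\<close>
    have "{} \<in> (nonstationary_ideal :: 'a set set)"
    proof -
      have "club_in UNIV (UNIV :: 'a set)"
        unfolding club_in_def closed_in_def unbounded_in_def by auto
      then show ?thesis unfolding nonstationary_ideal_def stationary_def by blast
    qed
    then show ?case using nonstationary_ideal_subset_id_p[OF gp] by auto
  next
    case (insert A \<A>)
    then have "- trace_set e A \<in> id_p S C I" "(\<Union>A\<in>\<A>. - trace_set e A) \<in> id_p S C I"
      using gen by auto
    then show ?case using id_p_Un[OF bdd gp] unfolding UN_insert by blast
  qed
  moreover have "- X \<subseteq> (\<Union>A\<in>\<A>. - trace_set e A)" using sub by blast
  ultimately show ?thesis using id_p_mono[OF gp] by blast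
qed

theorem theorem3p5:
  fixes \<mu> :: "'a::wellorder" and S :: "'a set"
    and C :: "'a \<Rightarrow> 'a set" and I :: "'a \<Rightarrow> 'a set set" and e :: "'a \<Rightarrow> 'a set"
  assumes "singular_cardinal \<mu>"
    and "succ_cardinal_type \<mu>"
    and "stationary S"
    and "S \<subseteq> {\<delta>. cf \<delta> = cf \<mu>}"
    and "good_pair \<mu> S C I"
    and "C_sequence e"
    and "\<forall>\<alpha>. |e \<alpha>| <o |{..<\<mu>}|"
    and "swallows e S C"
  shows "filter_sets (trace_filter e) \<inter> id_p S C I = {} \<and>
    trace_filter e \<noteq> bot \<and> uniform_filter (trace_filter e) \<and>
    filter_sets (trace_filter e) \<inter> nonstationary_ideal = {}"
proof -
  note gp = \<open>good_pair \<mu> S C I\<close>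
  have inf: "infinite {..<\<mu>}" and card: "\<forall>\<alpha><\<mu>. |{..<\<alpha>}| <o |{..<\<mu>}|"
    using assms(1) unfolding singular_cardinal_def by auto
  note reg = cardSuc_type_regular[OF inf assms(2)]
  \<comment> \<open>A countable range has size at most \<mu>, hence below \<lambda>, and is bounded
    by regularity.\<close>
  have bdd: "\<exists>b. \<forall>n. f n < b" for f :: "nat \<Rightarrow> 'a"
  proof -
    have "|range f| \<le>o |{..<\<mu>}|"
      using card_of_image[of f UNIV] inf infinite_iff_card_of_nat ordLeq_transitive by blast
    then have "|range f| <o |UNIV::'a set|" using reg(2) ordLeq_ordLess_trans by blast
    then show ?thesis using reg(1)[of "range f"] not_ordLess_ordIso by blast
  qed
  have gen: "- trace_set e A \<in> id_p S C I" if "unbounded_in UNIV A" for A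
    using Compl_trace_set_in_id_p[OF bdd inf card gp assms(6,7,8) that] .
  have disj: "X \<notin> id_p S C I" if "X \<in> filter_sets (trace_filter e)" for X
  proof
    assume "X \<in> id_p S C I"
    \<comment> \<open>The complement of \<open>X\<close> is in the ideal already, so
      \<open>X\<close> cannot be without making the ideal improper.\<close>
    then have "X \<union> - X \<in> id_p S C I"
      using id_p_Un[OF bdd gp] Compl_in_id_p_of_trace_filter[OF bdd gp gen that] by blast
    then show False using UNIV_notin_id_p[OF gp] by simp
  qed
  then have stat: "stationary X" if "X \<in> filter_sets (trace_filter e)" for X
    using nonstationary_ideal_subset_id_p[OF gp] that unfolding nonstationary_ideal_def by blast
  \<comment> \<open>Stationary sets have elements above any given point, so the empty set is not
    stationary and cannot belong to the filter.\<close>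
  have "\<not> stationary ({} :: 'a set)" using stationary_gt[OF bdd] by blast
  then have "trace_filter e \<noteq> bot" using stat[of "{}"] unfolding filter_sets_def by auto
  moreover have "uniform_filter (trace_filter e)"
    unfolding uniform_filter_def
  proof (rule ballI, rule ccontr)
    \<comment> \<open>A set not of size \<lambda> is bounded by regularity, while members of the
      filter are stationary and hence unbounded.\<close>
    fix X assume X: "X \<in> filter_sets (trace_filter e)" "\<not> |X| =o |UNIV::'a set|"
    then obtain c where "\<forall>x\<in>X. x < c" using reg(1)[OF X(2)] by blast
    moreover obtain x where "x \<in> X" "c < x"
      using stationary_gt[OF bdd stat[OF X(1)]] by blast
    ultimately show False using less_asym by blast
  qed
  ultimately show ?thesis
    using disj stat unfolding nonstationary_ideal_def by blast
qed

end
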